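(* Let $f$ be a non-negative $C^1$ function on the interval $[0,1]$ with $\int_0^1 f^2\,dx = 1$. Then $$\pi^2 \int_0^1 f^2 \log f \,dx \;\leq\; \int_0^1 (f')^2\,dx.$$
   Context: $\log$ denotes the natural logarithm, and $0^2\log 0$ is interpreted as $0$. *)

theory Defs
  imports "HOL-Analysis.Analysis"
begin

end

theory Submission
  imports Defs "HOL-Real_Asymp.Real_Asymp"
begin

text \<open>Put \<open>u = f\<^sup>2\<close>; the claim reads \<open>2 \<pi>\<^sup>2 \<integral> u ln u \<le> \<integral> u'\<^sup>2 / u\<close>. Let \<open>u\<close> evolve by the heat
  equation with Neumann boundary conditions. The entropy \<open>H = \<integral> u ln u\<close> decreases at rate the
  Fisher information \<open>J = \<integral> u'\<^sup>2 / u\<close>, and Wirtinger's inequality applied to \<open>(\<surd>u)'\<close>, which vanishes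
  at the boundary, gives \<open>dJ/dt \<le> - 2 \<pi>\<^sup>2 J\<close>. Hence \<open>J - 2 \<pi>\<^sup>2 H\<close> is nonincreasing; as \<open>H\<close> tends to \<open>0\<close>,
  it is nonnegative at time \<open>0\<close>. For a cosine polynomial the flow is explicit, and a general \<open>u\<close> is
  approximated by positive cosine polynomials with bounded, pointwise convergent derivatives.\<close>

section \<open>Dissipation of the Fisher information\<close>

lemma sin_pi_pos:
  assumes "0 < x" "x < 1"
  shows "sin (pi * x) > 0"
  using assms by (intro sin_gt_zero) auto

text \<open>The cotangent is a solution of the Riccati equation belonging to the optimal constant, so
  \<open>g'\<^sup>2 - \<pi>\<^sup>2 g\<^sup>2\<close> is the square \<open>(g' - \<pi> cot (\<pi>x) g)\<^sup>2\<close> plus the derivative of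
  \<open>\<pi> cot (\<pi>x) g\<^sup>2\<close>.\<close>

lemma wirtinger:
  fixes g g' :: "real \<Rightarrow> real"
  assumes deriv: "\<And>x. x \<in> {0..1} \<Longrightarrow> (g has_real_derivative g' x) (at x within {0..1})"
    and cont: "continuous_on {0..1} g'" and g0: "g 0 = 0" and g1: "g 1 = 0"
  shows "pi\<^sup>2 * integral {0..1} (\<lambda>x. (g x)\<^sup>2) \<le> integral {0..1} (\<lambda>x. (g' x)\<^sup>2)"
proof -
  define F where "F x = pi * cot (pi * x) * (g x)\<^sup>2" for x
  have contg: "continuous_on {0..1} g"
    by (rule DERIV_continuous_on[OF deriv])
  \<comment> \<open>At an end point \<open>cot\<close> blows up, but \<open>F\<close> is a product
    of convergent factors: the difference quotient of \<open>g\<close>,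
    \<open>(x - c) / sin (pi * x)\<close>, a cosine, and \<open>g x\<close>, which tends to 0. The
    value \<open>F c\<close> is 0 because \<open>g c = 0\<close>.\<close>
  have lim: "(F \<longlongrightarrow> F c) (at c within {0..1})"
    if c: "c \<in> {0, 1}" and s: "((\<lambda>x. (x - c) / sin (pi * x)) \<longlongrightarrow> l) (at c)" for c l
  proof -
    have cin: "c \<in> {0..1}" and gc: "g c = 0" using c g0 g1 by auto
    have "((\<lambda>x. (g x - g c) / (x - c)) \<longlongrightarrow> g' c) (at c within {0..1})"
      using deriv[OF cin] by (simp add: has_field_derivative_iff)
    moreover have "((\<lambda>x. (x - c) / sin (pi * x)) \<longlongrightarrow> l) (at c within {0..1})"
      using s by (rule tendsto_within_subset[OF _ subset_UNIV])
    moreover have "(g \<longlongrightarrow> 0) (at c within {0..1})"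
      using contg cin gc by (metis continuous_on)
    moreover have "((\<lambda>x. pi * cos (pi * x)) \<longlongrightarrow> pi * cos (pi * c)) (at c within {0..1})"
      by (intro tendsto_intros)
    ultimately have "((\<lambda>x. (pi * cos (pi * x)) * ((g x - g c) / (x - c)) * ((x - c) / sin (pi * x)) * g x)
        \<longlongrightarrow> (pi * cos (pi * c)) * g' c * l * 0) (at c within {0..1})"
      by (intro tendsto_mult tendsto_cos tendsto_const tendsto_ident_at)
    moreover have "\<forall>\<^sub>F x in at c within {0..1}.
        (pi * cos (pi * x)) * ((g x - g c) / (x - c)) * ((x - c) / sin (pi * x)) * g x = F x"
      unfolding eventually_at_filter
      by (rule always_eventually) (auto simp: F_def cot_def gc power2_eq_square)
    ultimately have "(F \<longlongrightarrow> 0) (at c within {0..1})"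
      by (simp add: Lim_transform_eventually)
    then show ?thesis by (simp add: F_def gc)
  qed
  have dF: "(F has_real_derivative
      (2 * pi * cot (pi * x) * g x * g' x - pi\<^sup>2 * (g x)\<^sup>2 - (pi * cot (pi * x) * g x)\<^sup>2)) (at x)"
    if "x \<in> {0<..<1}" for x
  proof -
    have s: "sin (pi * x) > 0" using that by (intro sin_pi_pos) auto
    have "(g has_real_derivative g' x) (at x)"
      using deriv[of x] that by (simp add: at_within_Icc_at)
    then have "(F has_real_derivative
      (pi * (- inverse ((sin (pi * x))\<^sup>2) * pi)) * (g x)\<^sup>2 + pi * cot (pi * x) * (2 * g x * g' x)) (at x)"
      unfolding F_def using s
      by (auto intro!: derivative_eq_intros DERIV_chain2[OF DERIV_cot])
    moreover have "inverse ((sin (pi * x))\<^sup>2) = 1 + (cot (pi * x))\<^sup>2"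
      using s sin_cos_squared_add[of "pi * x"] by (simp add: cot_def field_simps)
    ultimately show ?thesis
      by (simp add: algebra_simps power2_eq_square)
  qed
  have lim0: "((\<lambda>x. (x - 0) / sin (pi * x)) \<longlongrightarrow> inverse pi) (at 0)"
    and lim1: "((\<lambda>x. (x - 1) / sin (pi * x)) \<longlongrightarrow> - inverse pi) (at 1)"
    by real_asymp+
  have "continuous_on {0..1} F"
    unfolding continuous_on
  proof
    fix x :: real assume x: "x \<in> {0..1}"
    then consider "x = 0" | "x = 1" | "x \<in> {0<..<1}" by fastforce
    then show "(F \<longlongrightarrow> F x) (at x within {0..1})"
    proof cases
      case 3
      then show ?thesis
        using DERIV_isCont[OF dF[OF 3]]
        by (meson continuous_at_imp_continuous_at_within continuous_within)
    qed (use lim lim0 lim1 in auto)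
  qed
  then have "((\<lambda>x. 2 * pi * cot (pi * x) * g x * g' x - pi\<^sup>2 * (g x)\<^sup>2 - (pi * cot (pi * x) * g x)\<^sup>2)
      has_integral F 1 - F 0) {0..1}"
    using dF by (intro fundamental_theorem_of_calculus_interior)
      (auto simp: has_real_derivative_iff_has_vector_derivative)
  then have 1: "((\<lambda>x. 2 * pi * cot (pi * x) * g x * g' x - pi\<^sup>2 * (g x)\<^sup>2 - (pi * cot (pi * x) * g x)\<^sup>2)
      has_integral 0) {0..1}"
    by (simp add: F_def g0 g1)
  have i: "(\<lambda>x. (g' x)\<^sup>2) integrable_on {0..1}" "(\<lambda>x. (g x)\<^sup>2) integrable_on {0..1}"
    by (intro integrable_continuous_interval continuous_intros cont contg)+
  then have 2: "((\<lambda>x. (g' x)\<^sup>2 - pi\<^sup>2 * (g x)\<^sup>2) has_integral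
      integral {0..1} (\<lambda>x. (g' x)\<^sup>2) - pi\<^sup>2 * integral {0..1} (\<lambda>x. (g x)\<^sup>2)) {0..1}"
    by (intro has_integral_diff has_integral_mult_right integrable_integral)
  have "0 \<le> integral {0..1} (\<lambda>x. (g' x)\<^sup>2) - pi\<^sup>2 * integral {0..1} (\<lambda>x. (g x)\<^sup>2)"
  proof (rule has_integral_le[OF 1 2])
    \<comment> \<open>The comparison holds at the end points too: division by zero gives
      \<open>cot\<close> the value 0 there, and a square remains a square.\<close>
    fix x
    have "0 \<le> (g' x - pi * cot (pi * x) * g x)\<^sup>2" by simp
    then show "2 * pi * cot (pi * x) * g x * g' x - pi\<^sup>2 * (g x)\<^sup>2 - (pi * cot (pi * x) * g x)\<^sup>2
        \<le> (g' x)\<^sup>2 - pi\<^sup>2 * (g x)\<^sup>2"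
      by (simp add: power2_diff algebra_simps)
  qed
  then show ?thesis by simp
qed

text \<open>The integrated Bochner inequality: the left-hand side is the time derivative, along the heat
  flow, of the Fisher information on the right. With \<open>g = (\<surd>u)'\<close> the integrand on the left plus
  \<open>8 g'\<^sup>2\<close> is the derivative of \<open>2 u' u'' / u - u'\<^sup>3 / (3 u\<^sup>2)\<close> minus \<open>u'\<^sup>4 / (6 u\<^sup>3)\<close>.\<close>

lemma fisher_dissipation:
  fixes u u1 u2 u3 :: "real \<Rightarrow> real"
  assumes d0: "\<And>x. x \<in> {0..1} \<Longrightarrow> (u has_real_derivative u1 x) (at x within {0..1})"
    and d1: "\<And>x. x \<in> {0..1} \<Longrightarrow> (u1 has_real_derivative u2 x) (at x within {0..1})"
    and d2: "\<And>x. x \<in> {0..1} \<Longrightarrow> (u2 has_real_derivative u3 x) (at x within {0..1})"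
    and c3: "continuous_on {0..1} u3"
    and pos: "\<And>x. x \<in> {0..1} \<Longrightarrow> u x > 0"
    and neumann: "u1 0 = 0" "u1 1 = 0"
  shows "integral {0..1} (\<lambda>x. 2 * u1 x * u3 x / u x - (u1 x)\<^sup>2 * u2 x / (u x)\<^sup>2)
      \<le> - 2 * pi\<^sup>2 * integral {0..1} (\<lambda>x. (u1 x)\<^sup>2 / u x)"
proof -
  have c [continuous_intros]: "continuous_on {0..1} u" "continuous_on {0..1} u1" "continuous_on {0..1} u2"
    using d0 d1 d2 by (blast intro: DERIV_continuous_on)+
  note c3 [continuous_intros]
  have nz: "u x \<noteq> 0" if "x \<in> {0..1}" for x using pos[OF that] by simp
  define g where "g x = u1 x / (2 * sqrt (u x))" for x
  define g' where "g' x = u2 x / (2 * sqrt (u x)) - (u1 x)\<^sup>2 / (4 * u x * sqrt (u x))" for x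
  have "pi\<^sup>2 * integral {0..1} (\<lambda>x. (g x)\<^sup>2) \<le> integral {0..1} (\<lambda>x. (g' x)\<^sup>2)"
  proof (rule wirtinger)
    show "(g has_real_derivative g' x) (at x within {0..1})" if x: "x \<in> {0..1}" for x
      unfolding g_def g'_def using pos[OF x]
      by (auto intro!: derivative_eq_intros d0[OF x] d1[OF x] simp: divide_simps power2_eq_square)
    show "continuous_on {0..1} g'"
      unfolding g'_def using nz by (intro continuous_intros) auto
  qed (auto simp: g_def neumann)
  moreover have "integral {0..1} (\<lambda>x. (g x)\<^sup>2) = integral {0..1} (\<lambda>x. (u1 x)\<^sup>2 / u x) / 4"
    unfolding integral_divide[symmetric]
    by (rule integral_cong) (use pos in \<open>auto simp: g_def power_divide power_mult_distrib less_imp_le\<close>)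
  \<comment> \<open>The factor 4 in \<open>u1^2 / u = 4 g^2\<close> and the 2 of the target constant
    make the 8 that the pointwise comparison below has to supply.\<close>
  ultimately have w: "2 * pi\<^sup>2 * integral {0..1} (\<lambda>x. (u1 x)\<^sup>2 / u x) \<le> 8 * integral {0..1} (\<lambda>x. (g' x)\<^sup>2)"
    by simp
  \<comment> \<open>Both terms carry a factor \<open>u1\<close>, so the Neumann condition makes the
    boundary values of this primitive vanish.\<close>
  define P where "P x = 2 * u1 x * u2 x / u x - u1 x ^ 3 / (3 * (u x)\<^sup>2)" for x
  define P' where "P' x = 2 * u1 x * u3 x / u x + 2 * (u2 x)\<^sup>2 / u x - 3 * (u1 x)\<^sup>2 * u2 x / (u x)\<^sup>2
      + 2 / 3 * u1 x ^ 4 / u x ^ 3" for x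
  have "(P' has_integral P 1 - P 0) {0..1}"
  proof (rule fundamental_theorem_of_calculus)
    fix x :: real assume x: "x \<in> {0..1}"
    show "(P has_vector_derivative P' x) (at x within {0..1})"
      unfolding has_real_derivative_iff_has_vector_derivative[symmetric] P_def P'_def using nz[OF x]
      by (auto intro!: derivative_eq_intros d0[OF x] d1[OF x] d2[OF x])
         (simp add: field_simps eval_nat_numeral)
  qed simp
  then have P: "(P' has_integral 0) {0..1}" by (simp add: P_def neumann)
  have g': "((\<lambda>x. 8 * (g' x)\<^sup>2) has_integral 8 * integral {0..1} (\<lambda>x. (g' x)\<^sup>2)) {0..1}"
    unfolding g'_def using nz
    by (intro has_integral_mult_right integrable_integral integrable_continuous_interval continuous_intros) auto
  have "((\<lambda>x. 2 * u1 x * u3 x / u x - (u1 x)\<^sup>2 * u2 x / (u x)\<^sup>2) has_integral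
      integral {0..1} (\<lambda>x. 2 * u1 x * u3 x / u x - (u1 x)\<^sup>2 * u2 x / (u x)\<^sup>2)) {0..1}"
    using nz by (intro integrable_integral integrable_continuous_interval continuous_intros) auto
  moreover have "2 * u1 x * u3 x / u x - (u1 x)\<^sup>2 * u2 x / (u x)\<^sup>2 \<le> P' x - 8 * (g' x)\<^sup>2"
    if x: "x \<in> {0..1}" for x
  proof -
    have g': "8 * (g' x)\<^sup>2 = 2 * (u2 x)\<^sup>2 / u x - 2 * (u1 x)\<^sup>2 * u2 x / (u x)\<^sup>2 + u1 x ^ 4 / (2 * u x ^ 3)"
    proof -
      \<comment> \<open>Over the common factor \<open>sqrt (u x)\<close>, squaring removes the
        root.\<close>
      have "(g' x)\<^sup>2 = ((2 * u x * u2 x - (u1 x)\<^sup>2) / (4 * u x))\<^sup>2 / (sqrt (u x))\<^sup>2"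
        unfolding g'_def power_divide[symmetric] using pos[OF x]
        by (intro arg_cong[where f = "\<lambda>z. z\<^sup>2"]) (simp add: field_simps)
      then show ?thesis
        using pos[OF x] by (simp add: field_simps eval_nat_numeral)
    qed
    have "P' x - 8 * (g' x)\<^sup>2 = 2 * u1 x * u3 x / u x - (u1 x)\<^sup>2 * u2 x / (u x)\<^sup>2 + u1 x ^ 4 / (6 * u x ^ 3)"
      unfolding g' P'_def using nz[OF x] by (simp add: field_simps)
    moreover have "u1 x ^ 4 / (6 * u x ^ 3) \<ge> 0"
      using pos[OF x] by simp
    ultimately show ?thesis by linarith
  qed
  ultimately have "integral {0..1} (\<lambda>x. 2 * u1 x * u3 x / u x - (u1 x)\<^sup>2 * u2 x / (u x)\<^sup>2)
      \<le> 0 - 8 * integral {0..1} (\<lambda>x. (g' x)\<^sup>2)"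
    by (rule has_integral_le[OF _ has_integral_diff[OF P g']])
  then show ?thesis using w by simp
qed

section \<open>The heat flow on cosine sums\<close>

text \<open>The modes \<open>cos (k pi x)\<close> are the Neumann eigenfunctions of the interval,
  with eigenvalues \<open>(k pi)^2\<close>, so differentiation and the heat flow both act on the
  coefficients.\<close>

definition cos_sum :: "(nat \<Rightarrow> real) \<Rightarrow> nat \<Rightarrow> real \<Rightarrow> real" where
  "cos_sum a N x = (\<Sum>k\<le>N. a k * cos (real k * pi * x))"

definition sin_sum :: "(nat \<Rightarrow> real) \<Rightarrow> nat \<Rightarrow> real \<Rightarrow> real" where
  "sin_sum a N x = (\<Sum>k\<le>N. a k * sin (real k * pi * x))"

lemma has_real_derivative_cos_sum:
  "(cos_sum a N has_real_derivative - sin_sum (\<lambda>k. real k * pi * a k) N x) (at x within S)"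
  unfolding cos_sum_def sin_sum_def sum_negf[symmetric]
  by (auto intro!: derivative_eq_intros sum.cong)

lemma has_real_derivative_sin_sum:
  "(sin_sum a N has_real_derivative cos_sum (\<lambda>k. real k * pi * a k) N x) (at x within S)"
  unfolding cos_sum_def sin_sum_def
  by (auto intro!: derivative_eq_intros sum.cong)

lemma sin_sum_0 [simp]: "sin_sum a N 0 = 0"
  by (simp add: sin_sum_def)

lemma sin_sum_1 [simp]: "sin_sum a N 1 = 0"
  by (simp add: sin_sum_def)

text \<open>\<open>cos (k x)\<close> is the Chebyshev polynomial \<open>T_k\<close> at
  \<open>cos x\<close>; the three-term recurrence gives this by induction. It lets bounds on the
  unit interval extend to the whole line.\<close>

lemma cos_multiple_cong:
  fixes x y :: real
  assumes "cos x = cos y"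
  shows "cos (real k * x) = cos (real k * y)"
proof (induction k rule: less_induct)
  case (less k)
  have rec: "cos (real (Suc (Suc j)) * z) = 2 * cos z * cos (real (Suc j) * z) - cos (real j * z)" for j and z :: real
  proof -
    have "cos (real (Suc j) * z + z) + cos (real (Suc j) * z - z) = 2 * cos z * cos (real (Suc j) * z)"
      by (simp add: cos_add cos_diff)
    then show ?thesis by (simp add: algebra_simps)
  qed
  consider "k = 0" | "k = 1" | j where "k = Suc (Suc j)"
    by (metis One_nat_def not0_implies_Suc)
  then show ?case
  proof cases
    case 3
    then show ?thesis
      using less.IH[of j] less.IH[of "Suc j"] assms unfolding 3 rec by simp
  qed (use assms in auto)
qed

text \<open>The multiplier \<open>cos (k \<pi> s)\<close> is the action of the average \<open>(u (x + s) + u (x - s)) / 2\<close>, which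
  preserves lower bounds; the heat multiplier is a limit of powers of such multipliers.\<close>

lemma heat_flow_ge:
  assumes m: "\<And>x. x \<in> {0..1} \<Longrightarrow> m \<le> cos_sum a N x" and t: "t \<ge> 0"
  shows "m \<le> cos_sum (\<lambda>k. a k * exp (- (real k * pi)\<^sup>2 * t)) N x"
proof -
  have base: "m \<le> cos_sum a N x" for x
  proof -
    \<comment> \<open>The representative of \<open>x\<close> in the unit interval under reflection
      at 0 and translation by 2.\<close>
    define y where "y = arccos (cos (pi * x)) / pi"
    have b: "0 \<le> arccos (cos (pi * x))" "arccos (cos (pi * x)) \<le> pi"
      by (intro arccos_lbound arccos_ubound; simp)+
    then have y: "y \<in> {0..1}" by (auto simp: y_def)
    have "cos (pi * y) = cos (pi * x)" by (simp add: y_def)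
    then have "cos (real k * pi * y) = cos (real k * pi * x)" for k
      using cos_multiple_cong[of "pi * y" "pi * x" k] by (simp add: mult.assoc)
    then have "cos_sum a N y = cos_sum a N x" by (simp add: cos_sum_def)
    then show ?thesis using m[OF y] by simp
  qed
  have avg: "m \<le> cos_sum (\<lambda>k. a k * cos (real k * pi * s) ^ n) N x" for s n x
  proof (induction n arbitrary: x)
    case (Suc n)
    let ?c = "cos_sum (\<lambda>k. a k * cos (real k * pi * s) ^ n) N"
    have "cos_sum (\<lambda>k. a k * cos (real k * pi * s) ^ Suc n) N x = (?c (x + s) + ?c (x - s)) / 2"
      unfolding cos_sum_def sum.distrib[symmetric] sum_divide_distrib
      by (intro sum.cong refl) (simp add: cos_add cos_diff ring_distribs)
    then show ?case using Suc[of "x + s"] Suc[of "x - s"] by simp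
  qed (use base in simp)
  \<comment> \<open>Central limit scaling: \<open>cos (c / sqrt n) ^ n\<close> tends to
    \<open>exp (- c^2 / 2)\<close>, and the step \<open>sqrt (2 t) / sqrt n\<close> gives
    \<open>c = k pi sqrt (2 t)\<close>, hence \<open>c^2 / 2 = (k pi)^2 t\<close>.\<close>
  have "(\<lambda>n. cos (real k * pi * (sqrt (2 * t) / sqrt (real n))) ^ n) \<longlonglongrightarrow> exp (- (real k * pi)\<^sup>2 * t)" for k
  proof -
    have "(\<lambda>n. cos (c / sqrt (real n)) ^ n) \<longlonglongrightarrow> exp (- (c * c / 2))" for c :: real
      by real_asymp
    from this[of "real k * pi * sqrt (2 * t)"] show ?thesis
      using t by (simp add: power2_eq_square mult_ac)
  qed
  then have "(\<lambda>n. cos_sum (\<lambda>k. a k * cos (real k * pi * (sqrt (2 * t) / sqrt (real n))) ^ n) N x)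
      \<longlonglongrightarrow> cos_sum (\<lambda>k. a k * exp (- (real k * pi)\<^sup>2 * t)) N x"
    unfolding cos_sum_def by (intro tendsto_intros)
  then show ?thesis
    by (rule LIMSEQ_le_const) (use avg in blast)
qed

text \<open>Since \<open>a 0\<close> is the mean, \<open>a 0 = 1\<close> normalises the density and
  makes the constant 1 the limit of the flow. The claim follows by comparing
  \<open>J - 2 pi^2 H\<close> at time 0 with its limiting lower bound.\<close>

lemma log_sobolev_cos_sum:
  assumes pos: "\<And>x. x \<in> {0..1} \<Longrightarrow> cos_sum a N x > 0" and a0: "a 0 = 1"
  shows "2 * pi\<^sup>2 * integral {0..1} (\<lambda>x. cos_sum a N x * ln (cos_sum a N x))
    \<le> integral {0..1} (\<lambda>x. (sin_sum (\<lambda>k. real k * pi * a k) N x)\<^sup>2 / cos_sum a N x)"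
proof -
  \<comment> \<open>Coefficients of the flow at time \<open>t\<close>. \<open>U1\<close>,
    \<open>U2\<close>, \<open>U3\<close> are the space derivatives of \<open>U\<close>; by the heat
    equation \<open>U2\<close> and \<open>U3\<close> are also the time derivatives of
    \<open>U\<close> and \<open>U1\<close>.\<close>
  define e where "e t k = a k * exp (- (real k * pi)\<^sup>2 * t)" for t k
  define U where "U t = cos_sum (e t) N" for t
  define U1 where "U1 t x = - sin_sum (\<lambda>k. real k * pi * e t k) N x" for t x
  define U2 where "U2 t x = - cos_sum (\<lambda>k. real k * pi * (real k * pi * e t k)) N x" for t x
  define U3 where "U3 t x = sin_sum (\<lambda>k. real k * pi * (real k * pi * (real k * pi * e t k))) N x" for t x
  define H where "H t = integral {0..1} (\<lambda>x. U t x * ln (U t x))" for t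
  define J where "J t = integral {0..1} (\<lambda>x. (U1 t x)\<^sup>2 / U t x)" for t
  \<comment> \<open>Compactness turns pointwise positivity into a positive minimum, which the flow
    preserves.\<close>
  have Upos: "U t x > 0" if t: "t \<ge> 0" for t x
  proof -
    have "continuous_on {0..1} (cos_sum a N)"
      by (rule DERIV_continuous_on[OF has_real_derivative_cos_sum])
    then obtain z where z: "z \<in> {0..1}" "\<And>y. y \<in> {0..1} \<Longrightarrow> cos_sum a N z \<le> cos_sum a N y"
      using continuous_attains_inf[of "{0..1::real}" "cos_sum a N"] by auto
    have "cos_sum a N z \<le> U t x"
      unfolding U_def e_def using z(2) t by (rule heat_flow_ge)
    then show ?thesis using pos[OF z(1)] by linarith
  qed
  have Unz: "U t x \<noteq> 0" if "t \<ge> 0" for t x using Upos[OF that, of x] by simp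
  have dx: "(U t has_real_derivative U1 t x) (at x within S)"
    "(U1 t has_real_derivative U2 t x) (at x within S)"
    "(U2 t has_real_derivative U3 t x) (at x within S)" for t x S
    unfolding U_def U1_def U2_def U3_def
    by (auto intro!: derivative_eq_intros has_real_derivative_cos_sum has_real_derivative_sin_sum)
  have dt: "((\<lambda>t. U t x) has_real_derivative U2 t x) (at t within S)"
    "((\<lambda>t. U1 t x) has_real_derivative U3 t x) (at t within S)" for t x S
    unfolding U_def U1_def U2_def U3_def cos_sum_def sin_sum_def e_def sum_negf[symmetric]
    by (auto intro!: derivative_eq_intros sum.cong simp: power2_eq_square)
  have cont [continuous_intros]: "continuous_on S (\<lambda>p. U (fst p) (snd p))"
    "continuous_on S (\<lambda>p. U1 (fst p) (snd p))" "continuous_on S (\<lambda>p. U2 (fst p) (snd p))"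
    "continuous_on S (\<lambda>p. U3 (fst p) (snd p))" for S
    unfolding U_def U1_def U2_def U3_def cos_sum_def sin_sum_def e_def
    by (intro continuous_intros)+
  have contx [continuous_intros]: "continuous_on S (U t)" "continuous_on S (U1 t)"
    "continuous_on S (U2 t)" "continuous_on S (U3 t)" for S t
    unfolding U_def U1_def U2_def U3_def cos_sum_def sin_sum_def
    by (intro continuous_intros)+
  have bd: "U1 t 0 = 0" "U1 t 1 = 0" for t by (auto simp: U1_def)
  have dH: "(H has_real_derivative - J t) (at t within {0..})" if t: "t \<in> {0..}" for t
  proof -
    have "((\<lambda>t. integral (cbox 0 1) (\<lambda>x. U t x * ln (U t x))) has_real_derivative
        integral (cbox 0 1) (\<lambda>x. U2 t x * (ln (U t x) + 1))) (at t within {0..})"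
    proof (rule leibniz_rule_field_derivative[OF _ _ _ t])
      show "((\<lambda>t. U t x * ln (U t x)) has_real_derivative U2 s x * (ln (U s x) + 1)) (at s within {0..})"
        if "s \<in> {0..}" for s x
        using Upos[of s x] that
        by (auto intro!: derivative_eq_intros dt simp: field_simps)
      show "(\<lambda>x. U s x * ln (U s x)) integrable_on cbox 0 1" if "s \<in> {0..}" for s
        using Unz[of s] that by (intro integrable_continuous continuous_intros) auto
      show "continuous_on ({0..} \<times> cbox 0 1) (\<lambda>(s, x). U2 s x * (ln (U s x) + 1))"
        unfolding case_prod_unfold using Unz by (intro continuous_intros) auto
    qed auto
    \<comment> \<open>Integration by parts: the primitive \<open>U1 (ln U + 1)\<close> vanishes at
      both ends.\<close>
    moreover have "integral (cbox 0 1) (\<lambda>x. U2 t x * (ln (U t x) + 1)) = - J t"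
    proof -
      have "((\<lambda>x. U2 t x * (ln (U t x) + 1) + (U1 t x)\<^sup>2 / U t x) has_integral
          U1 t 1 * (ln (U t 1) + 1) - U1 t 0 * (ln (U t 0) + 1)) {0..1}"
      proof (rule fundamental_theorem_of_calculus)
        fix x :: real
        show "((\<lambda>x. U1 t x * (ln (U t x) + 1)) has_vector_derivative
            U2 t x * (ln (U t x) + 1) + (U1 t x)\<^sup>2 / U t x) (at x within {0..1})"
          unfolding has_real_derivative_iff_has_vector_derivative[symmetric] using Upos[of t x] t
          by (auto intro!: derivative_eq_intros dx simp: field_simps power2_eq_square)
      qed simp
      then have 1: "((\<lambda>x. U2 t x * (ln (U t x) + 1) + (U1 t x)\<^sup>2 / U t x) has_integral 0) {0..1}"
        by (simp add: bd)
      have "((\<lambda>x. (U1 t x)\<^sup>2 / U t x) has_integral J t) {0..1}"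
        unfolding J_def using Unz[of t] t
        by (intro integrable_integral integrable_continuous_interval continuous_intros) auto
      from has_integral_diff[OF 1 this] show ?thesis by (simp add: integral_unique)
    qed
    ultimately show ?thesis by (simp add: H_def[abs_def])
  qed
  define J' where "J' t = integral {0..1} (\<lambda>x. 2 * U1 t x * U3 t x / U t x - (U1 t x)\<^sup>2 * U2 t x / (U t x)\<^sup>2)" for t
  have dJ: "(J has_real_derivative J' t) (at t within {0..})" if t: "t \<in> {0..}" for t
  proof -
    have "((\<lambda>t. integral (cbox 0 1) (\<lambda>x. (U1 t x)\<^sup>2 / U t x)) has_real_derivative
        integral (cbox 0 1) (\<lambda>x. 2 * U1 t x * U3 t x / U t x - (U1 t x)\<^sup>2 * U2 t x / (U t x)\<^sup>2)) (at t within {0..})"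
    proof (rule leibniz_rule_field_derivative[OF _ _ _ t])
      show "((\<lambda>t. (U1 t x)\<^sup>2 / U t x) has_real_derivative
          2 * U1 s x * U3 s x / U s x - (U1 s x)\<^sup>2 * U2 s x / (U s x)\<^sup>2) (at s within {0..})"
        if "s \<in> {0..}" for s x
        using Unz[of s x] that
        by (auto intro!: derivative_eq_intros dt simp: field_simps power2_eq_square)
      show "(\<lambda>x. (U1 s x)\<^sup>2 / U s x) integrable_on cbox 0 1" if "s \<in> {0..}" for s
        using Unz[of s] that by (intro integrable_continuous continuous_intros) auto
      show "continuous_on ({0..} \<times> cbox 0 1)
          (\<lambda>(s, x). 2 * U1 s x * U3 s x / U s x - (U1 s x)\<^sup>2 * U2 s x / (U s x)\<^sup>2)"
        unfolding case_prod_unfold using Unz by (intro continuous_intros) auto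
    qed auto
    then show ?thesis by (simp add: J_def[abs_def] J'_def)
  qed
  \<comment> \<open>As \<open>H' = - J\<close>, its derivative is \<open>J' + 2 pi^2 J\<close>,
    which is nonpositive by the dissipation inequality.\<close>
  define K where "K t = J t - 2 * pi\<^sup>2 * H t" for t
  have K_le: "K T \<le> K 0" if "T \<ge> 0" for T
  proof (rule DERIV_nonpos_imp_decreasing_open[OF that])
    have dK: "(K has_real_derivative J' t + 2 * pi\<^sup>2 * J t) (at t within {0..})" if "t \<in> {0..}" for t
      unfolding K_def[abs_def] by (auto intro!: derivative_eq_intros dH dJ that)
    then have "continuous_on {0..} K" by (rule DERIV_continuous_on)
    then show "continuous_on {0..T} K" by (rule continuous_on_subset) auto
    fix t assume t: "0 < t" "t < T"
    have "J' t \<le> - 2 * pi\<^sup>2 * J t"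
      unfolding J'_def J_def using t
      by (intro fisher_dissipation dx contx Upos bd) auto
    moreover have "(K has_real_derivative J' t + 2 * pi\<^sup>2 * J t) (at t)"
      using dK[of t] t at_within_interior[of t "{0..}"] by simp
    ultimately show "\<exists>y. (K has_real_derivative y) (at t) \<and> y \<le> 0"
      by (intro exI[of _ "J' t + 2 * pi\<^sup>2 * J t"]) auto
  qed
  \<comment> \<open>Every mode with \<open>k >= 1\<close> decays at least like
    \<open>exp (- pi^2 T)\<close>, so \<open>A\<close> times this factor bounds \<open>U - 1\<close>
    uniformly in \<open>x\<close>.\<close>
  define A where "A = (\<Sum>k=1..N. \<bar>a k\<bar>)"
  have A: "A \<ge> 0" by (simp add: A_def sum_nonneg)
  \<comment> \<open>Because \<open>J\<close> is nonnegative, an upper bound on \<open>H\<close>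
    suffices: \<open>U\<close> is at most \<open>1 + A\<close>, and \<open>ln y <= y - 1\<close>
    bounds the logarithm by the decaying distance to 1.\<close>
  have K_ge: "- (2 * pi\<^sup>2 * ((1 + A) * (A * exp (- pi\<^sup>2 * T)))) \<le> K T" if T: "T \<ge> 0" for T
  proof -
    have close: "\<bar>U T x - 1\<bar> \<le> A * exp (- pi\<^sup>2 * T)" for x
    proof -
      have "{..N} = insert 0 {1..N}" by auto
      then have "U T x - 1 = (\<Sum>k=1..N. e T k * cos (real k * pi * x))"
        by (simp add: U_def cos_sum_def e_def a0)
      also have "\<bar>\<dots>\<bar> \<le> (\<Sum>k=1..N. \<bar>a k\<bar> * exp (- pi\<^sup>2 * T))"
      proof (rule order.trans[OF sum_abs sum_mono])
        fix k assume "k \<in> {1..N}"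
        then have "1 * pi\<^sup>2 * T \<le> (real k)\<^sup>2 * pi\<^sup>2 * T"
          using T by (intro mult_right_mono) auto
        then have "exp (- (real k * pi)\<^sup>2 * T) \<le> exp (- pi\<^sup>2 * T)"
          by (simp add: power_mult_distrib)
        then show "\<bar>e T k * cos (real k * pi * x)\<bar> \<le> \<bar>a k\<bar> * exp (- pi\<^sup>2 * T)"
          unfolding e_def abs_mult
          using mult_mono[of "exp (- (real k * pi)\<^sup>2 * T)" "exp (- pi\<^sup>2 * T)" "\<bar>cos (real k * pi * x)\<bar>" 1]
          by (auto simp: mult.assoc intro!: mult_left_mono)
      qed
      finally show ?thesis by (simp add: A_def sum_distrib_right)
    qed
    have "H T \<le> integral {0..1} (\<lambda>x::real. (1 + A) * (A * exp (- pi\<^sup>2 * T)))"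
      unfolding H_def
    proof (rule integral_le)
      show "(\<lambda>x. U T x * ln (U T x)) integrable_on {0..1}"
        using Unz[OF T] by (intro integrable_continuous_interval continuous_intros) auto
      fix x :: real
      have "exp (- pi\<^sup>2 * T) \<le> 1" using T by simp
      then have "A * exp (- pi\<^sup>2 * T) \<le> A" using A by (simp add: mult_left_le)
      then have "U T x \<le> 1 + A" using close[of x] by linarith
      moreover have "ln (U T x) \<le> A * exp (- pi\<^sup>2 * T)"
        using close[of x] ln_le_minus_one[OF Upos[OF T, of x]] by linarith
      ultimately show "U T x * ln (U T x) \<le> (1 + A) * (A * exp (- pi\<^sup>2 * T))"
        using Upos[OF T, of x] A by (intro order.trans[OF mult_left_mono mult_right_mono]) auto
    qed (rule integrable_const_ivl)
    then have "H T \<le> (1 + A) * (A * exp (- pi\<^sup>2 * T))" by simp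
    then have "2 * pi\<^sup>2 * H T \<le> 2 * pi\<^sup>2 * ((1 + A) * (A * exp (- pi\<^sup>2 * T)))"
      by (intro mult_left_mono) auto
    moreover have "J T \<ge> 0"
      unfolding J_def using Upos[OF T] Unz[OF T]
      by (intro integral_nonneg integrable_continuous_interval continuous_intros) (auto simp: less_imp_le)
    ultimately show ?thesis unfolding K_def by linarith
  qed
  have "((\<lambda>T. exp (- pi\<^sup>2 * T)) \<longlongrightarrow> 0) at_top"
    using pi_gt_zero by real_asymp
  then have "((\<lambda>T. - (2 * pi\<^sup>2 * ((1 + A) * (A * exp (- pi\<^sup>2 * T))))) \<longlongrightarrow> - (2 * pi\<^sup>2 * ((1 + A) * (A * 0)))) at_top"
    by (intro tendsto_intros)
  then have "- (2 * pi\<^sup>2 * ((1 + A) * (A * 0))) \<le> K 0"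
  proof (rule tendsto_upperbound)
    show "\<forall>\<^sub>F T in at_top. - (2 * pi\<^sup>2 * ((1 + A) * (A * exp (- pi\<^sup>2 * T)))) \<le> K 0"
      using eventually_ge_at_top[of 0] by eventually_elim (use K_le K_ge order.trans in blast)
  qed simp
  then have "2 * pi\<^sup>2 * H 0 \<le> J 0" by (simp add: K_def)
  moreover have "e 0 = a" by (simp add: e_def fun_eq_iff)
  ultimately show ?thesis by (simp add: H_def J_def U_def U1_def)
qed

section \<open>Approximation by cosine polynomials\<close>

text \<open>The primitive of each mode with \<open>k > 0\<close> vanishes at both ends. Thus unit
  mass becomes the condition \<open>a 0 = 1\<close>.\<close>

lemma integral_cos_sum: "integral {0..1} (cos_sum a N) = a 0"
proof -
  have "((\<lambda>x. a k * cos (real k * pi * x)) has_integral (if k = 0 then a 0 else 0)) {0..1}" for k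
  proof (cases "k = 0")
    case False
    have "((\<lambda>x. a k * cos (real k * pi * x)) has_integral
        a k * sin (real k * pi * 1) / (real k * pi) - a k * sin (real k * pi * 0) / (real k * pi)) {0..1}"
      using False by (intro fundamental_theorem_of_calculus)
        (auto intro!: derivative_eq_intros simp: has_real_derivative_iff_has_vector_derivative[symmetric])
    then show ?thesis using False by simp
  qed (use has_integral_const_real[of "a 0" 0 1] in simp)
  then have "((\<lambda>x. \<Sum>k\<le>N. a k * cos (real k * pi * x)) has_integral (\<Sum>k\<le>N. if k = 0 then a 0 else 0)) {0..1}"
    by (intro has_integral_sum) auto
  then show ?thesis by (simp add: cos_sum_def[abs_def] integral_unique)
qed

section \<open>Polynomials in the cosine as cosine sums\<close>

lemma cos_sum_add: "\<exists>c K. \<forall>x. cos_sum a N x + cos_sum b M x = cos_sum c K x"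
proof (intro exI allI)
  fix x
  \<comment> \<open>Entries of \<open>a\<close> beyond \<open>N\<close> and of \<open>b\<close>
    beyond \<open>M\<close> are arbitrary, so both sequences are cut off before they are
    added.\<close>
  let ?c = "\<lambda>k. (if k \<le> N then a k else 0) + (if k \<le> M then b k else 0)"
  have pad: "cos_sum d L x = (\<Sum>k\<le>max N M. (if k \<le> L then d k else 0) * cos (real k * pi * x))"
    if "L \<le> max N M" for d L
    unfolding cos_sum_def using that by (intro sum.mono_neutral_cong_left) auto
  show "cos_sum a N x + cos_sum b M x = cos_sum ?c (max N M) x"
    unfolding pad[of N a, simplified] pad[of M b, simplified]
    by (simp only: cos_sum_def[of ?c] distrib_right sum.distrib)
qed

lemma cos_sum_monomial: "\<exists>b M. \<forall>x. c * cos (real k * pi * x) = cos_sum b M x"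
  by (intro exI[of _ "\<lambda>j. if j = k then c else 0"] exI[of _ k])
    (simp add: cos_sum_def if_distrib[of "\<lambda>z. z * _"] cong: if_cong)

text \<open>Product-to-sum: \<open>2 cos y cos (k y) = cos ((k - 1) y) + cos ((k + 1) y)\<close>,
  applied to the top mode in an induction on \<open>N\<close>.\<close>

lemma cos_mult_cos_sum: "\<exists>b M. \<forall>x. cos (pi * x) * cos_sum a N x = cos_sum b M x"
proof (induction N)
  case 0
  show ?case using cos_sum_monomial[of "a 0" 1] by (simp add: cos_sum_def mult.commute)
next
  case (Suc N)
  then obtain b M where b: "\<And>x. cos (pi * x) * cos_sum a N x = cos_sum b M x" by blast
  obtain c K where c: "\<And>x. a (Suc N) / 2 * cos (real N * pi * x) = cos_sum c K x"
    using cos_sum_monomial by blast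
  obtain d L where d: "\<And>x. a (Suc N) / 2 * cos (real (Suc (Suc N)) * pi * x) = cos_sum d L x"
    using cos_sum_monomial by blast
  have split: "cos (pi * x) * cos_sum a (Suc N) x = cos_sum b M x + (cos_sum c K x + cos_sum d L x)" for x
  proof -
    have "real N * pi * x = real (Suc N) * pi * x - pi * x" "real (Suc (Suc N)) * pi * x = real (Suc N) * pi * x + pi * x"
      by (simp_all add: algebra_simps)
    then show ?thesis
      unfolding b[symmetric] c[symmetric] d[symmetric]
      by (simp only: cos_add cos_diff) (simp add: cos_sum_def algebra_simps)
  qed
  obtain e I where e: "\<And>x. cos_sum c K x + cos_sum d L x = cos_sum e I x"
    using cos_sum_add by blast
  show ?case unfolding split e by (rule cos_sum_add)
qed

text \<open>Horner's scheme. Density is available for polynomials in \<open>cos (pi x)\<close>,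
  whereas the heat flow needs cosine sums.\<close>

lemma poly_cos_eq_cos_sum: "\<exists>a N. \<forall>x. poly p (cos (pi * x)) = cos_sum a N x"
proof (induction p)
  case 0
  show ?case using cos_sum_monomial[of 0 0] by simp
next
  case (pCons c p)
  then obtain a N where a: "\<And>x. poly p (cos (pi * x)) = cos_sum a N x" by blast
  obtain b M where b: "\<And>x. cos (pi * x) * cos_sum a N x = cos_sum b M x"
    using cos_mult_cos_sum by blast
  obtain d K where d: "\<And>x. c = cos_sum d K x"
    using cos_sum_monomial[of c 0] by auto
  show ?case
    using cos_sum_add[of d K b M] by (simp add: a b flip: d)
qed

lemma log_sobolev_poly_cos:
  assumes pos: "\<And>x. x \<in> {0..1} \<Longrightarrow> poly p (cos (pi * x)) > 0"
    and norm: "integral {0..1} (\<lambda>x. poly p (cos (pi * x))) = 1"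
  shows "2 * pi\<^sup>2 * integral {0..1} (\<lambda>x. poly p (cos (pi * x)) * ln (poly p (cos (pi * x))))
    \<le> integral {0..1} (\<lambda>x. (pi * sin (pi * x) * poly (pderiv p) (cos (pi * x)))\<^sup>2 / poly p (cos (pi * x)))"
proof -
  obtain a N where a: "(\<lambda>x. poly p (cos (pi * x))) = cos_sum a N"
    using poly_cos_eq_cos_sum[of p] by (auto simp: fun_eq_iff)
  have "a 0 = 1" using norm unfolding a integral_cos_sum .
  moreover have "(pi * sin (pi * x) * poly (pderiv p) (cos (pi * x)))\<^sup>2
      = (sin_sum (\<lambda>k. real k * pi * a k) N x)\<^sup>2" for x
  proof -
    have "((\<lambda>x. poly p (cos (pi * x))) has_real_derivative
        poly (pderiv p) (cos (pi * x)) * (- sin (pi * x) * pi)) (at x)"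
      by (rule DERIV_chain2[OF poly_DERIV]) (auto intro!: derivative_eq_intros)
    \<comment> \<open>Uniqueness of the derivative matches the two expressions without computing
      \<open>a\<close>.\<close>
    from DERIV_unique[OF this has_real_derivative_cos_sum[of a N x UNIV, folded a]]
    show ?thesis by (simp add: power2_eq_square algebra_simps)
  qed
  ultimately show ?thesis
    using log_sobolev_cos_sum[of a N] pos by (simp add: a[symmetric, THEN fun_cong])
qed

section \<open>Tools for convergence and density\<close>

lemma ex_poly_antiderivative:
  fixes p :: "'a::field_char_0 poly"
  shows "\<exists>q. pderiv q = p"
proof
  show "pderiv (\<Sum>i\<le>degree p. monom (coeff p i / of_nat (Suc i)) (Suc i)) = p"
    by (simp add: higher_pderiv_sum[of 1, simplified] pderiv_monom poly_as_sum_of_monoms del: of_nat_Suc)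
qed

text \<open>Convergence is asked for on the open interval only, because the approximating
  derivatives vanish at the end points and need not converge to \<open>u'\<close> there.\<close>

lemma bounded_convergence_integral:
  fixes f :: "nat \<Rightarrow> real \<Rightarrow> real"
  assumes "\<And>n. continuous_on {a..b} (f n)"
    and "\<And>n x. x \<in> {a..b} \<Longrightarrow> \<bar>f n x\<bar> \<le> C"
    and "\<And>x. x \<in> {a<..<b} \<Longrightarrow> (\<lambda>n. f n x) \<longlonglongrightarrow> g x"
  shows "(\<lambda>n. integral {a..b} (f n)) \<longlonglongrightarrow> integral {a..b} g"
  unfolding integral_open_interval_real
proof (rule dominated_convergence(2))
  show "f n integrable_on {a<..<b}" for n
    using integrable_continuous_interval[OF assms(1)] by (simp add: integrable_on_open_interval_real)
  show "(\<lambda>x. C) integrable_on {a<..<b}"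
    by (simp add: integrable_on_open_interval_real integrable_const_ivl)
qed (use assms in auto)

text \<open>The limit at 0 agrees with the value \<open>0 * ln 0 = 0\<close>; this handles the zeros
  of \<open>f\<close> in the final limit.\<close>

lemma continuous_on_x_ln_x: "continuous_on {0..} (\<lambda>x::real. x * ln x)"
  unfolding continuous_on
proof
  fix x :: real assume x: "x \<in> {0..}"
  show "((\<lambda>x. x * ln x) \<longlongrightarrow> x * ln x) (at x within {0..})"
  proof (cases "x = 0")
    case True
    have "((\<lambda>x::real. x * ln x) \<longlongrightarrow> 0) (at_right 0)" by real_asymp
    then show ?thesis using True by (simp add: at_within_Ici_at_right)
  next
    case False
    then show ?thesis using x by (intro tendsto_intros) auto
  qed
qed

lemma continuous_on_Icc_bounded:
  fixes f :: "real \<Rightarrow> real"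
  assumes "continuous_on {a..b} f"
  obtains M where "\<And>x. x \<in> {a..b} \<Longrightarrow> \<bar>f x\<bar> \<le> M"
proof -
  have "bounded (f ` {a..b})"
    using assms by (intro compact_imp_bounded compact_continuous_image) auto
  then obtain M where "\<forall>x\<in>{a..b}. \<bar>f x\<bar> \<le> M" unfolding bounded_iff by auto
  then show ?thesis using that by blast
qed

text \<open>Stone-Weierstrass: these functions form an algebra with constants, and points are
  separated because \<open>cos\<close> is injective on \<open>[0, pi]\<close>.\<close>

lemma poly_cos_dense:
  assumes "continuous_on {0..1} f" "e > 0"
  shows "\<exists>p. \<forall>x\<in>{0..1}. \<bar>f x - poly p (cos (pi * x))\<bar> < e"
proof -
  have R: "function_ring_on (range (\<lambda>p x. poly p (cos (pi * x)))) {0..1::real}"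
  proof
    fix f :: "real \<Rightarrow> real" assume "f \<in> range (\<lambda>p x. poly p (cos (pi * x)))"
    then obtain p where "f = (\<lambda>x. poly p (cos (pi * x)))" by (elim rangeE)
    then show "continuous_on {0..1} f" by (simp only:) (intro continuous_intros)
  next
    fix x y :: real assume xy: "x \<in> {0..1}" "y \<in> {0..1}" "x \<noteq> y"
    have pi_mult: "0 \<le> pi * z" "pi * z \<le> pi" if "z \<in> {0..1}" for z
      using that by (simp_all add: mult_left_le)
    have "cos (pi * x) \<noteq> cos (pi * y)"
      using cos_inj_pi[OF pi_mult[OF xy(1)] pi_mult[OF xy(2)]] xy(3) by (metis mult_left_cancel pi_neq_zero)
    then have "poly [:0, 1:] (cos (pi * x)) \<noteq> poly [:0, 1:] (cos (pi * y))" by simp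
    moreover have "(\<lambda>x. poly [:0, 1:] (cos (pi * x))) \<in> range (\<lambda>p x. poly p (cos (pi * x)))"
      by (rule range_eqI[OF refl])
    ultimately show "\<exists>f\<in>range (\<lambda>p x. poly p (cos (pi * x))). f x \<noteq> f y"
      by (rule bexI)
  next
    fix f g :: "real \<Rightarrow> real"
    assume "f \<in> range (\<lambda>p x. poly p (cos (pi * x)))" "g \<in> range (\<lambda>p x. poly p (cos (pi * x)))"
    then obtain p q where "f = (\<lambda>x. poly p (cos (pi * x)))" "g = (\<lambda>x. poly q (cos (pi * x)))"
      by (elim rangeE)
    then have eqs: "(\<lambda>x. f x + g x) = (\<lambda>x. poly (p + q) (cos (pi * x)))"
      "(\<lambda>x. f x * g x) = (\<lambda>x. poly (p * q) (cos (pi * x)))"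
      by simp_all
    show "(\<lambda>x. f x + g x) \<in> range (\<lambda>p x. poly p (cos (pi * x)))"
      using eqs(1) by (rule range_eqI)
    show "(\<lambda>x. f x * g x) \<in> range (\<lambda>p x. poly p (cos (pi * x)))"
      using eqs(2) by (rule range_eqI)
  next
    fix c :: real
    show "(\<lambda>_. c) \<in> range (\<lambda>p x. poly p (cos (pi * x)))"
      by (rule range_eqI[of _ _ "[:c:]"]) simp
  qed simp
  show ?thesis
    using function_ring_on.Stone_Weierstrass_basic[OF R assms] by simp
qed

text \<open>Fundamental theorem between the two points, then enlargement of the interval. A bound in
  mean is what the approximation can use, as its derivatives need not converge uniformly.\<close>

lemma diff_le_integral_abs_deriv:
  fixes d d' :: "real \<Rightarrow> real"
  assumes deriv: "\<And>x. x \<in> {0..1} \<Longrightarrow> (d has_real_derivative d' x) (at x within {0..1})"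
    and cont: "continuous_on {0..1} d'" and x: "x \<in> {0..1}" and y: "y \<in> {0..1}"
  shows "d x - d y \<le> integral {0..1} (\<lambda>x. \<bar>d' x\<bar>)"
proof -
  have le: "\<bar>d t - d s\<bar> \<le> integral {0..1} (\<lambda>x. \<bar>d' x\<bar>)" if "0 \<le> s" "s \<le> t" "t \<le> 1" for s t
  proof -
    have sub: "{s..t} \<subseteq> {0..1}" using that by auto
    have "(d' has_integral d t - d s) {s..t}"
    proof (rule fundamental_theorem_of_calculus[OF \<open>s \<le> t\<close>])
      fix x assume "x \<in> {s..t}"
      then show "(d has_vector_derivative d' x) (at x within {s..t})"
        using deriv[of x] sub
        by (auto simp: has_real_derivative_iff_has_vector_derivative
            intro: has_vector_derivative_within_subset)
    qed
    then have "d t - d s = integral {s..t} d'" by (simp add: integral_unique)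
    also have "\<bar>\<dots>\<bar> \<le> integral {s..t} (\<lambda>x. \<bar>d' x\<bar>)"
      using continuous_on_subset[OF cont sub]
      by (intro order.trans[OF _ integral_norm_bound_integral[of d' "{s..t}" "\<lambda>x. \<bar>d' x\<bar>"]])
        (auto intro!: integrable_continuous_interval continuous_intros)
    also have "\<dots> \<le> integral {0..1} (\<lambda>x. \<bar>d' x\<bar>)"
      using sub continuous_on_subset[OF cont sub] cont
      by (intro integral_subset_le) (auto intro!: integrable_continuous_interval continuous_intros)
    finally show ?thesis .
  qed
  show ?thesis
    using le[of x y] le[of y x] x y by (cases "x \<le> y") auto
qed

text \<open>No boundary condition is imposed on \<open>u\<close>, whereas cosine polynomials satisfy the Neumann condition,
  so the derivatives cannot converge at the end points. They are taken as \<open>sin (\<pi>x) q\<^sub>n (cos (\<pi>x))\<close>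
  with \<open>q\<^sub>n (cos (\<pi>x))\<close> close to \<open>u' x / (sin (\<pi>x) + 1 / (n + 1))\<close>.\<close>

lemma poly_cos_approximation:
  fixes u u' :: "real \<Rightarrow> real"
  assumes deriv: "\<And>x. x \<in> {0..1} \<Longrightarrow> (u has_real_derivative u' x) (at x within {0..1})"
    and cont: "continuous_on {0..1} u'"
  obtains p :: "nat \<Rightarrow> real poly" and B where
    "\<And>n. integral {0..1} (\<lambda>x. poly (p n) (cos (pi * x))) = integral {0..1} u"
    "uniform_limit {0..1} (\<lambda>n x. poly (p n) (cos (pi * x))) u sequentially"
    "\<And>n x. x \<in> {0..1} \<Longrightarrow> \<bar>pi * sin (pi * x) * poly (pderiv (p n)) (cos (pi * x))\<bar> \<le> B"
    "\<And>x. x \<in> {0<..<1} \<Longrightarrow> (\<lambda>n. - (pi * sin (pi * x) * poly (pderiv (p n)) (cos (pi * x)))) \<longlonglongrightarrow> u' x"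
proof -
  have contu: "continuous_on {0..1} u" by (rule DERIV_continuous_on[OF deriv])
  obtain M where M: "\<And>x. x \<in> {0..1} \<Longrightarrow> \<bar>u' x\<bar> \<le> M"
    using continuous_on_Icc_bounded[OF cont] by blast
  have M0: "M \<ge> 0" using M[of 0] by simp
  have sin_nonneg: "sin (pi * x) \<ge> 0" if "x \<in> {0..1}" for x
    using that by (intro sin_ge_zero) (auto simp: mult_left_le)
  define h where "h n x = u' x / (sin (pi * x) + inverse (real (Suc n)))" for n x
  have den: "sin (pi * x) + inverse (real (Suc n)) > 0" if "x \<in> {0..1}" for x n
    using sin_nonneg[OF that] by (simp add: add_nonneg_pos)
  have "\<exists>q. \<forall>x\<in>{0..1}. \<bar>h n x - poly q (cos (pi * x))\<bar> < inverse (real (Suc n))" for n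
  proof (rule poly_cos_dense)
    show "continuous_on {0..1} (h n)"
      unfolding h_def using less_imp_neq[OF den, symmetric] by (intro continuous_intros cont) blast
  qed simp
  then have "\<exists>q. \<forall>n. \<forall>x\<in>{0..1}. \<bar>h n x - poly (q n) (cos (pi * x))\<bar> < inverse (real (Suc n))"
    by (intro choice allI)
  then obtain q where q: "\<And>n x. x \<in> {0..1} \<Longrightarrow> \<bar>h n x - poly (q n) (cos (pi * x))\<bar> < inverse (real (Suc n))"
    by blast
  define v where "v n x = sin (pi * x) * poly (q n) (cos (pi * x))" for n x
  have contv: "continuous_on S (v n)" for n S
    unfolding v_def by (intro continuous_intros)
  have vh: "\<bar>v n x - sin (pi * x) * h n x\<bar> \<le> inverse (real (Suc n))" if x: "x \<in> {0..1}" for n x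
  proof -
    have "\<bar>v n x - sin (pi * x) * h n x\<bar> = \<bar>sin (pi * x)\<bar> * \<bar>h n x - poly (q n) (cos (pi * x))\<bar>"
      unfolding v_def by (simp add: abs_mult[symmetric] algebra_simps abs_minus_commute)
    also have "\<dots> \<le> 1 * inverse (real (Suc n))"
      using q[OF x, of n] by (intro mult_mono) auto
    finally show ?thesis by simp
  qed
  have vB: "\<bar>v n x\<bar> \<le> M + 1" if x: "x \<in> {0..1}" for n x
  proof -
    \<comment> \<open>The quotient lies between 0 and 1, so the bound does not depend on
      \<open>n\<close>, although \<open>h n\<close> itself may grow.\<close>
    have "\<bar>sin (pi * x) * h n x\<bar> = \<bar>u' x\<bar> * (sin (pi * x) / (sin (pi * x) + inverse (real (Suc n))))"
      using den[OF x, of n] sin_nonneg[OF x] by (simp add: h_def abs_mult)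
    also have "\<dots> \<le> M * 1"
      using den[OF x, of n] sin_nonneg[OF x] M[OF x] by (intro mult_mono) auto
    finally have "\<bar>sin (pi * x) * h n x\<bar> \<le> M" by simp
    moreover have "inverse (real (Suc n)) \<le> 1" by (simp add: field_simps)
    ultimately show ?thesis using vh[OF x, of n] by linarith
  qed
  have inv_lim: "(\<lambda>n. inverse (real (Suc n))) \<longlonglongrightarrow> 0"
    by (rule LIMSEQ_inverse_real_of_nat)
  have v_lim: "(\<lambda>n. v n x) \<longlonglongrightarrow> u' x" if x: "x \<in> {0<..<1}" for x
  proof -
    have s: "sin (pi * x) > 0" using x by (intro sin_pi_pos) auto
    have lim: "(\<lambda>n. sin (pi * x) * h n x) \<longlonglongrightarrow> sin (pi * x) * (u' x / (sin (pi * x) + 0))"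
      unfolding h_def using s by (intro tendsto_intros inv_lim) auto
    have "(\<lambda>n. v n x - sin (pi * x) * h n x) \<longlonglongrightarrow> 0"
      using vh[of x] x by (intro Lim_null_comparison[OF _ inv_lim] always_eventually) auto
    from tendsto_add[OF this lim] show ?thesis
      using s by simp
  qed
  have "\<exists>Q. \<forall>n. pderiv (Q n) = q n"
    by (intro choice allI ex_poly_antiderivative)
  then obtain Q where Q: "\<And>n. pderiv (Q n) = q n" by blast
  \<comment> \<open>\<open>c n\<close> adjusts the mean to that of \<open>u\<close>. The factor
    \<open>- 1 / pi\<close> in \<open>p n\<close> cancels the \<open>- pi\<close> from
    differentiating \<open>cos (pi x)\<close>, so the derivative is \<open>v n\<close>.\<close>
  define c where "c n = integral {0..1} u + integral {0..1} (\<lambda>x. poly (Q n) (cos (pi * x))) / pi" for n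
  define p where "p n = [:c n:] - smult (1 / pi) (Q n)" for n
  have p_eval: "poly (p n) (cos (pi * x)) = c n - poly (Q n) (cos (pi * x)) / pi" for n x
    by (simp add: p_def)
  have dp: "pi * sin (pi * x) * poly (pderiv (p n)) (cos (pi * x)) = - v n x" for n x
    by (simp add: p_def pderiv_diff pderiv_smult Q v_def)
  have p_cont: "continuous_on S (\<lambda>x. poly (p n) (cos (pi * x)))" for n S
    by (intro continuous_intros)
  have p_int: "integral {0..1} (\<lambda>x. poly (p n) (cos (pi * x))) = integral {0..1} u" for n
  proof -
    have "((\<lambda>x. c n - poly (Q n) (cos (pi * x)) / pi) has_integral
        c n * (1 - 0) - integral {0..1} (\<lambda>x. poly (Q n) (cos (pi * x))) / pi) {0..1}"
      using has_integral_const_real[of "c n" 0 1]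
      by (intro has_integral_diff has_integral_divide integrable_integral
          integrable_continuous_interval continuous_intros) simp_all
    then show ?thesis by (simp add: p_eval c_def integral_unique)
  qed
  define d where "d n x = poly (p n) (cos (pi * x)) - u x" for n x
  have d_int: "(d n has_integral 0) {0..1}" for n
  proof -
    have "(d n has_integral integral {0..1} (\<lambda>x. poly (p n) (cos (pi * x))) - integral {0..1} u) {0..1}"
      unfolding d_def
      by (intro has_integral_diff integrable_integral integrable_continuous_interval p_cont contu)
    then show ?thesis by (simp add: p_int)
  qed
  have dd: "(d n has_real_derivative v n x - u' x) (at x within {0..1})" if x: "x \<in> {0..1}" for n x
  proof -
    have "((\<lambda>x. poly (p n) (cos (pi * x))) has_real_derivative
        poly (pderiv (p n)) (cos (pi * x)) * (- sin (pi * x) * pi)) (at x within {0..1})"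
      by (rule DERIV_chain2[OF poly_DERIV]) (auto intro!: derivative_eq_intros)
    moreover have "poly (pderiv (p n)) (cos (pi * x)) * (- sin (pi * x) * pi) = v n x"
      using dp[of x n] by (simp add: mult_ac)
    ultimately show ?thesis
      unfolding d_def[abs_def] by (intro DERIV_diff deriv x) simp
  qed
  define E where "E n = integral {0..1} (\<lambda>x. \<bar>v n x - u' x\<bar>)" for n
  \<comment> \<open>A function of integral zero is bounded by its oscillation: average
    \<open>d n x - d n y <= E n\<close> over \<open>y\<close>, and likewise with the roles
    exchanged.\<close>
  have d_le: "\<bar>d n x\<bar> \<le> E n" if x: "x \<in> {0..1}" for n x
  proof -
    have le: "d n y - d n z \<le> E n" if "y \<in> {0..1}" "z \<in> {0..1}" for y z
      unfolding E_def
      by (rule diff_le_integral_abs_deriv[OF dd _ that]) (assumption, intro continuous_intros contv cont)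
    have const: "((\<lambda>_::real. r) has_integral r) {0..1}" for r :: real
      using has_integral_const_real[of r 0 1] by simp
    have "d n x - E n \<le> 0"
      by (rule has_integral_le[OF const d_int[of n]]) (use le[OF x] in \<open>simp add: algebra_simps\<close>)
    moreover have "0 \<le> d n x + E n"
      by (rule has_integral_le[OF d_int[of n] const]) (use le[OF _ x] in \<open>simp add: algebra_simps\<close>)
    ultimately show ?thesis by linarith
  qed
  have "(\<lambda>n. integral {0..1} (\<lambda>x. \<bar>v n x - u' x\<bar>)) \<longlonglongrightarrow> integral {0..1} (\<lambda>x::real. 0::real)"
  proof (rule bounded_convergence_integral)
    show "continuous_on {0..1} (\<lambda>x. \<bar>v n x - u' x\<bar>)" for n
      by (intro continuous_intros contv cont)
    show "\<bar>\<bar>v n x - u' x\<bar>\<bar> \<le> M + 1 + M" if "x \<in> {0..1}" for n x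
      using vB[OF that, of n] M[OF that] by linarith
    show "(\<lambda>n. \<bar>v n x - u' x\<bar>) \<longlonglongrightarrow> 0" if "x \<in> {0<..<1}" for x
      using v_lim[OF that] by (intro tendsto_rabs_zero) (simp add: LIM_zero)
  qed
  then have E: "E \<longlonglongrightarrow> 0" by (simp add: E_def[abs_def])
  have "uniform_limit {0..1} (\<lambda>n x. poly (p n) (cos (pi * x))) u sequentially"
    unfolding uniform_limit_iff
  proof (intro allI impI)
    fix e :: real assume "e > 0"
    then have "\<forall>\<^sub>F n in sequentially. E n < e" using E by (rule order_tendstoD(2)[rotated])
    then show "\<forall>\<^sub>F n in sequentially. \<forall>x\<in>{0..1}. dist (poly (p n) (cos (pi * x))) (u x) < e"
    proof eventually_elim
      case (elim n)
      show ?case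
        using order.strict_trans1[OF d_le elim] by (simp add: dist_real_def d_def)
    qed
  qed
  then show ?thesis
    by (intro that[of p "M + 1"]) (simp_all only: dp p_int vB v_lim abs_minus_cancel minus_minus)
qed

section \<open>Passage to the limit for positive densities\<close>

lemma log_sobolev_positive:
  fixes u u' :: "real \<Rightarrow> real"
  assumes deriv: "\<And>x. x \<in> {0..1} \<Longrightarrow> (u has_real_derivative u' x) (at x within {0..1})"
    and cont: "continuous_on {0..1} u'"
    and pos: "\<And>x. x \<in> {0..1} \<Longrightarrow> u x > 0"
    and norm: "integral {0..1} u = 1"
  shows "2 * pi\<^sup>2 * integral {0..1} (\<lambda>x. u x * ln (u x)) \<le> integral {0..1} (\<lambda>x. (u' x)\<^sup>2 / u x)"
proof -
  obtain p B where p: "\<And>n. integral {0..1} (\<lambda>x. poly (p n) (cos (pi * x))) = 1"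
    "uniform_limit {0..1} (\<lambda>n x. poly (p n) (cos (pi * x))) u sequentially"
    "\<And>n x. x \<in> {0..1} \<Longrightarrow> \<bar>pi * sin (pi * x) * poly (pderiv (p n)) (cos (pi * x))\<bar> \<le> B"
    "\<And>x. x \<in> {0<..<1} \<Longrightarrow> (\<lambda>n. - (pi * sin (pi * x) * poly (pderiv (p n)) (cos (pi * x)))) \<longlonglongrightarrow> u' x"
    using poly_cos_approximation[OF deriv cont] unfolding norm by metis
  have contu: "continuous_on {0..1} u" by (rule DERIV_continuous_on[OF deriv])
  obtain z where z: "z \<in> {0..1}" "\<And>x. x \<in> {0..1} \<Longrightarrow> u z \<le> u x"
    using continuous_attains_inf[OF _ _ contu] by auto
  obtain B' where B': "\<And>x. x \<in> {0..1} \<Longrightarrow> \<bar>u x\<bar> \<le> B'"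
    using continuous_on_Icc_bounded[OF contu] by blast
  \<comment> \<open>Half the minimum of \<open>u\<close>: an approximation within \<open>m\<close>
    of \<open>u\<close> stays above \<open>m\<close>.\<close>
  define m where "m = u z / 2"
  have m: "m > 0" using pos[OF z(1)] by (simp add: m_def)
  have "\<forall>\<^sub>F n in sequentially. \<forall>x\<in>{0..1}. dist (poly (p n) (cos (pi * x))) (u x) < m"
    using p(2) m unfolding uniform_limit_iff by blast
  then obtain k where k: "\<And>n x. n \<ge> k \<Longrightarrow> x \<in> {0..1} \<Longrightarrow> dist (poly (p n) (cos (pi * x))) (u x) < m"
    unfolding eventually_sequentially by blast
  \<comment> \<open>The shift by \<open>k\<close> makes the bounds valid for every \<open>n\<close>.
    \<open>V\<close> is minus the derivative of \<open>U\<close>; the sign disappears on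
    squaring.\<close>
  define U where "U n x = poly (p (n + k)) (cos (pi * x))" for n x
  define V where "V n x = pi * sin (pi * x) * poly (pderiv (p (n + k))) (cos (pi * x))" for n x
  have U: "m \<le> U n x" "U n x \<le> B' + m" if "x \<in> {0..1}" for n x
  proof -
    have "\<bar>U n x - u x\<bar> < m"
      using k[of "n + k" x] that by (simp add: U_def dist_real_def)
    moreover have "2 * m \<le> u x" using z(2)[OF that] by (simp add: m_def)
    ultimately show "m \<le> U n x" "U n x \<le> B' + m" using B'[OF that] by linarith+
  qed
  have Upos: "U n x > 0" if "x \<in> {0..1}" for n x using U(1)[OF that] m by (rule less_le_trans[rotated])
  have contUV [continuous_intros]: "continuous_on S (U n)" "continuous_on S (V n)" for S n
    unfolding U_def V_def by (intro continuous_intros)+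
  have lim: "(\<lambda>n. U n x) \<longlonglongrightarrow> u x" if "x \<in> {0<..<1}" for x
    unfolding U_def using tendsto_uniform_limitI[OF p(2), of x] that
    by (intro LIMSEQ_ignore_initial_segment) auto
  have limV: "(\<lambda>n. - V n x) \<longlonglongrightarrow> u' x" if "x \<in> {0<..<1}" for x
    unfolding V_def using LIMSEQ_ignore_initial_segment[OF p(4)[OF that], of k] by simp
  have "continuous_on {0..B' + m} (\<lambda>t. t * ln t)"
    by (rule continuous_on_subset[OF continuous_on_x_ln_x]) auto
  from continuous_on_Icc_bounded[OF this]
  obtain C where C: "\<And>t. t \<in> {0..B' + m} \<Longrightarrow> \<bar>t * ln t\<bar> \<le> C" by blast
  have H: "(\<lambda>n. integral {0..1} (\<lambda>x. U n x * ln (U n x))) \<longlonglongrightarrow> integral {0..1} (\<lambda>x. u x * ln (u x))"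
  proof (rule bounded_convergence_integral)
    show "continuous_on {0..1} (\<lambda>x. U n x * ln (U n x))" for n
      using Upos[of _ n] by (intro continuous_intros) fastforce
    show "\<bar>U n x * ln (U n x)\<bar> \<le> C" if "x \<in> {0..1}" for n x
      using U[OF that] Upos[OF that, of n] by (intro C) auto
    show "(\<lambda>n. U n x * ln (U n x)) \<longlonglongrightarrow> u x * ln (u x)" if "x \<in> {0<..<1}" for x
      using pos[of x] that by (intro tendsto_intros lim) auto
  qed
  have J: "(\<lambda>n. integral {0..1} (\<lambda>x. (V n x)\<^sup>2 / U n x)) \<longlonglongrightarrow> integral {0..1} (\<lambda>x. (u' x)\<^sup>2 / u x)"
  proof (rule bounded_convergence_integral)
    show "continuous_on {0..1} (\<lambda>x. (V n x)\<^sup>2 / U n x)" for n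
      using Upos[of _ n] by (intro continuous_intros) fastforce
    show "\<bar>(V n x)\<^sup>2 / U n x\<bar> \<le> B\<^sup>2 / m" if "x \<in> {0..1}" for n x
    proof -
      have "(V n x)\<^sup>2 \<le> B\<^sup>2" using p(3)[OF that, of "n + k"] by (simp add: V_def abs_le_square_iff[symmetric])
      then have "(V n x)\<^sup>2 / U n x \<le> B\<^sup>2 / m" using U(1)[OF that, of n] m by (intro frac_le) auto
      then show ?thesis using Upos[OF that, of n] by simp
    qed
    show "(\<lambda>n. (V n x)\<^sup>2 / U n x) \<longlonglongrightarrow> (u' x)\<^sup>2 / u x" if "x \<in> {0<..<1}" for x
    proof -
      have "(\<lambda>n. (- V n x)\<^sup>2 / U n x) \<longlonglongrightarrow> (u' x)\<^sup>2 / u x"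
        using pos[of x] that by (intro tendsto_intros lim limV) auto
      then show ?thesis by simp
    qed
  qed
  show ?thesis
  proof (rule LIMSEQ_le[OF tendsto_mult[OF tendsto_const H] J])
    have "2 * pi\<^sup>2 * integral {0..1} (\<lambda>x. U n x * ln (U n x)) \<le> integral {0..1} (\<lambda>x. (V n x)\<^sup>2 / U n x)" for n
      unfolding U_def V_def
      by (rule log_sobolev_poly_cos) (use Upos[of _ n] p(1) in \<open>simp_all add: U_def\<close>)
    then show "\<exists>N. \<forall>n\<ge>N. 2 * pi\<^sup>2 * integral {0..1} (\<lambda>x. U n x * ln (U n x))
        \<le> integral {0..1} (\<lambda>x. (V n x)\<^sup>2 / U n x)" by blast
  qed
qed

section \<open>The inequality for nonnegative functions\<close>

theorem theorem2p2:
  fixes f f' :: "real \<Rightarrow> real"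
  assumes deriv: "\<forall>x\<in>{0..1}. (f has_real_derivative f' x) (at x within {0..1})"
    and cont_deriv: "continuous_on {0..1} f'"
    and nonneg: "\<forall>x\<in>{0..1}. f x \<ge> 0"
    and norm: "integral {0..1} (\<lambda>x. (f x)\<^sup>2) = 1"
  shows "pi\<^sup>2 * integral {0..1} (\<lambda>x. (f x)\<^sup>2 * ln (f x)) \<le> integral {0..1} (\<lambda>x. (f' x)\<^sup>2)"
proof -
  have contf: "continuous_on {0..1} f" using deriv by (intro DERIV_continuous_on) auto
  define s where "s n = inverse (real (Suc (Suc n)))" for n
  have s: "0 < s n" "s n < 1" for n by (auto simp: s_def field_simps)
  have s_lim: "s \<longlonglongrightarrow> 0"
    unfolding s_def using LIMSEQ_Suc[OF LIMSEQ_inverse_real_of_nat] .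
  \<comment> \<open>Mixing \<open>f^2\<close> with the constant density 1 keeps the mass equal to 1
    and gives positivity where \<open>f\<close> vanishes.\<close>
  define u where "u n x = (1 - s n) * (f x)\<^sup>2 + s n" for n x
  define u' where "u' n x = (1 - s n) * (2 * f x * f' x)" for n x
  have upos: "u n x > 0" for n x
    unfolding u_def using s[of n] by (intro add_nonneg_pos) auto
  have contu [continuous_intros]: "continuous_on {0..1} (u n)" "continuous_on {0..1} (u' n)" for n
    unfolding u_def u'_def by (intro continuous_intros contf cont_deriv)+
  have lsi: "2 * pi\<^sup>2 * integral {0..1} (\<lambda>x. u n x * ln (u n x)) \<le> 4 * integral {0..1} (\<lambda>x. (f' x)\<^sup>2)" for n
  proof -
    have "2 * pi\<^sup>2 * integral {0..1} (\<lambda>x. u n x * ln (u n x)) \<le> integral {0..1} (\<lambda>x. (u' n x)\<^sup>2 / u n x)"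
    proof (rule log_sobolev_positive)
      show "(u n has_real_derivative u' n x) (at x within {0..1})" if "x \<in> {0..1}" for x
        unfolding u_def u'_def using deriv that by (auto intro!: derivative_eq_intros)
      have "(u n has_integral (1 - s n) * integral {0..1} (\<lambda>x. (f x)\<^sup>2) + s n) {0..1}"
        unfolding u_def using has_integral_const_real[of "s n" 0 1]
        by (intro has_integral_add has_integral_mult_right integrable_integral
            integrable_continuous_interval continuous_intros contf) simp_all
      then show "integral {0..1} (u n) = 1" by (simp add: integral_unique norm)
    qed (simp_all add: upos contu)
    also have "\<dots> \<le> integral {0..1} (\<lambda>x. 4 * (f' x)\<^sup>2)"
    proof (rule integral_le)
      show "(\<lambda>x. (u' n x)\<^sup>2 / u n x) integrable_on {0..1}"
        using less_imp_neq[OF upos, symmetric] by (intro integrable_continuous_interval continuous_intros) blast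
      show "(\<lambda>x. 4 * (f' x)\<^sup>2) integrable_on {0..1}"
        by (intro integrable_continuous_interval continuous_intros cont_deriv)
      fix x
      \<comment> \<open>In \<open>u'^2\<close> one factor \<open>1 - s n\<close> together with
        \<open>f^2\<close> is absorbed by \<open>u n\<close>, and the other is at most 1. No
        division by \<open>f\<close> occurs, so its zeros are covered.\<close>
      have "(1 - s n) * (f x)\<^sup>2 \<le> u n x" using s[of n] by (simp add: u_def)
      moreover have "(1 - s n) * (4 * (f' x)\<^sup>2) \<le> 1 * (4 * (f' x)\<^sup>2)"
        using s[of n] by (intro mult_right_mono) auto
      ultimately have "((1 - s n) * (f x)\<^sup>2) * ((1 - s n) * (4 * (f' x)\<^sup>2)) \<le> u n x * (1 * (4 * (f' x)\<^sup>2))"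
        using upos[of n x] s[of n] by (intro mult_mono) auto
      moreover have "(u' n x)\<^sup>2 = ((1 - s n) * (f x)\<^sup>2) * ((1 - s n) * (4 * (f' x)\<^sup>2))"
        by (simp add: u'_def power2_eq_square)
      ultimately show "(u' n x)\<^sup>2 / u n x \<le> 4 * (f' x)\<^sup>2"
        using upos[of n x] by (simp add: divide_le_eq mult.commute)
    qed
    finally show ?thesis by simp
  qed
  obtain M where M: "\<And>x. x \<in> {0..1} \<Longrightarrow> \<bar>f x\<bar> \<le> M"
    using continuous_on_Icc_bounded[OF contf] by blast
  have "continuous_on {0..M\<^sup>2 + 1} (\<lambda>t. t * ln t)"
    by (rule continuous_on_subset[OF continuous_on_x_ln_x]) auto
  from continuous_on_Icc_bounded[OF this]
  obtain C where C: "\<And>t. t \<in> {0..M\<^sup>2 + 1} \<Longrightarrow> \<bar>t * ln t\<bar> \<le> C" by blast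
  have "(\<lambda>n. integral {0..1} (\<lambda>x. u n x * ln (u n x))) \<longlonglongrightarrow> integral {0..1} (\<lambda>x. (f x)\<^sup>2 * ln ((f x)\<^sup>2))"
  proof (rule bounded_convergence_integral)
    show "continuous_on {0..1} (\<lambda>x. u n x * ln (u n x))" for n
      using less_imp_neq[OF upos, symmetric] by (intro continuous_intros) blast
    show "\<bar>u n x * ln (u n x)\<bar> \<le> C" if x: "x \<in> {0..1}" for n x
    proof (rule C)
      have "(f x)\<^sup>2 \<le> M\<^sup>2" using M[OF x] by (simp add: abs_le_square_iff[symmetric])
      moreover have "(1 - s n) * (f x)\<^sup>2 \<le> 1 * (f x)\<^sup>2" using s[of n] by (intro mult_right_mono) auto
      ultimately have "u n x \<le> M\<^sup>2 + 1" using s[of n] by (simp add: u_def)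
      then show "u n x \<in> {0..M\<^sup>2 + 1}" using upos[of n x] by simp
    qed
    fix x
    have "(\<lambda>n. u n x) \<longlonglongrightarrow> (1 - 0) * (f x)\<^sup>2 + 0"
      unfolding u_def by (intro tendsto_intros s_lim)
    then have "(\<lambda>n. u n x) \<longlonglongrightarrow> (f x)\<^sup>2" by simp
    then show "(\<lambda>n. u n x * ln (u n x)) \<longlonglongrightarrow> (f x)\<^sup>2 * ln ((f x)\<^sup>2)"
      using continuous_on_tendsto_compose[OF continuous_on_x_ln_x, of "\<lambda>n. u n x" "(f x)\<^sup>2"] upos
      by (simp add: less_imp_le)
  qed
  then have "(\<lambda>n. 2 * pi\<^sup>2 * integral {0..1} (\<lambda>x. u n x * ln (u n x)))
      \<longlonglongrightarrow> 2 * pi\<^sup>2 * integral {0..1} (\<lambda>x. (f x)\<^sup>2 * ln ((f x)\<^sup>2))"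
    by (intro tendsto_intros)
  then have "2 * pi\<^sup>2 * integral {0..1} (\<lambda>x. (f x)\<^sup>2 * ln ((f x)\<^sup>2)) \<le> 4 * integral {0..1} (\<lambda>x. (f' x)\<^sup>2)"
    by (rule LIMSEQ_le_const2) (use lsi in blast)
  \<comment> \<open>\<open>ln (f^2) = 2 ln f\<close> supplies the factor that cancels the 4; where
    \<open>f\<close> vanishes, \<open>f^2\<close> makes both integrands 0.\<close>
  moreover have "integral {0..1} (\<lambda>x. (f x)\<^sup>2 * ln ((f x)\<^sup>2)) = integral {0..1} (\<lambda>x. 2 * ((f x)\<^sup>2 * ln (f x)))"
  proof (rule integral_cong)
    fix x :: real assume "x \<in> {0..1}"
    then have "f x \<ge> 0" using nonneg by simp
    then show "(f x)\<^sup>2 * ln ((f x)\<^sup>2) = 2 * ((f x)\<^sup>2 * ln (f x))"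
      by (cases "f x = 0") (simp_all add: ln_realpow)
  qed
  ultimately show ?thesis by simp
qed

end
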